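(* For every cubic graph $G$, $\nu_2(G) \geq \frac{16}{17}\cdot \frac{|V(G)| + 2\cdot \nu_3(G)}{4}$.
   Context: Graphs are finite, without loops, possibly with multiple edges; a graph is cubic if every vertex has degree $3$. For $k\geq 1$, $\nu_k(G)$ is the maximum number of edges of a $k$-edge-colorable subgraph of $G$. *)

theory Defs
  imports Complex_Main
begin

text \<open>A multigraph without loops: a vertex set V, an edge set E (edge identifiers, so
parallel edges are allowed) and an endpoint map ends assigning each edge a 2-element
set of vertices.\<close>

definition cubic_graph :: "'a set \<Rightarrow> 'e set \<Rightarrow> ('e \<Rightarrow> 'a set) \<Rightarrow> bool" where
  "cubic_graph V E ends \<longleftrightarrow>
     finite V \<and> finite E \<and>
     (\<forall>e\<in>E. ends e \<subseteq> V \<and> card (ends e) = 2) \<and>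
     (\<forall>v\<in>V. card {e\<in>E. v \<in> ends e} = 3)"

definition k_edge_colorable :: "nat \<Rightarrow> ('e \<Rightarrow> 'a set) \<Rightarrow> 'e set \<Rightarrow> bool" where
  "k_edge_colorable k ends F \<longleftrightarrow>
     (\<exists>c :: 'e \<Rightarrow> nat. (\<forall>e\<in>F. c e < k) \<and>
        (\<forall>e1\<in>F. \<forall>e2\<in>F. e1 \<noteq> e2 \<and> ends e1 \<inter> ends e2 \<noteq> {} \<longrightarrow> c e1 \<noteq> c e2))"

definition nu :: "nat \<Rightarrow> 'e set \<Rightarrow> ('e \<Rightarrow> 'a set) \<Rightarrow> nat" where
  "nu k E ends = Max {card F | F. F \<subseteq> E \<and> k_edge_colorable k ends F}"

end

theory Submission
  imports Defs
begin

text \<open>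
  Two bounds suffice: \<open>nu 2 \<ge> (2/3) nu 3\<close>, by dropping the smallest colour class, and
  \<open>nu 2 \<ge> (4/5) |V|\<close>. For the latter, partition \<open>V\<close> into paths, counting a path as free if it
  closes up to an even cycle; if \<open>p\<close> paths are not free, then \<open>nu 2 \<ge> |V| - p\<close>, and the claim is
  \<open>5 p \<le> |V|\<close>. In an optimal partition, an edge leaving an end of a non-free path leads to an
  interior vertex of a path whose ends are not adjacent (an open path): otherwise two paths could
  be joined. Here every vertex of a closable path counts as an end. An interior vertex absorbs only
  one such edge, and an open path sends out four of them besides its own path edges, so on average
  it occupies six vertices in total, its two ends and four absorbing vertices. In the same sense a
  closable path occupies at least five, unless it is bad: a single vertex, or a triangle with a
  doubled edge; a bad path still occupies four. If a bad path sends an edge to an interior vertex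
  \<open>v\<close> of an open path \<open>Q\<close>, then rerouting through \<open>v\<close> shows that both sides of \<open>Q - v\<close> are bad.
  This can happen for only one bad path per \<open>Q\<close>, so the surpluses of the open paths pay for the
  deficits of the bad ones.
\<close>

text \<open>Colour \<open>f i\<close> by the parity of \<open>i\<close>. The case
  \<open>m < length xs\<close> covers paths and \<open>m = length xs\<close> closed cycles, so both
  share one proof.\<close>

lemma two_edge_colorable_of_circular_indexing:
  fixes f :: "nat \<Rightarrow> 'e" and ends :: "'e \<Rightarrow> 'a set"
  assumes "distinct xs" "inj_on f {..<m}" "m \<le> length xs"
    and ev: "m = length xs \<Longrightarrow> even m"
    and f: "\<And>i. i < m \<Longrightarrow> ends (f i) = {xs ! i, xs ! (Suc i mod length xs)}"
  shows "k_edge_colorable 2 ends (f ` {..<m})"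
proof -
  define c where "c e = the_inv_into {..<m} f e mod 2" for e
  have c: "c (f i) = i mod 2" if "i < m" for i
    using that assms(2) by (simp add: c_def the_inv_into_f_f)
  have parity: "i mod 2 \<noteq> j mod 2" if "i < j" "j < m" "ends (f i) \<inter> ends (f j) \<noteq> {}" for i j
  proof -
    let ?k = "length xs"
    have k: "i < ?k" "j < ?k" "Suc i mod ?k = Suc i" using that assms(3) by auto
    have nth: "xs ! a = xs ! b \<longleftrightarrow> a = b" if "a < ?k" "b < ?k" for a b
      using that assms(1) by (simp add: nth_eq_iff_index_eq)
    have "0 < ?k" using k by linarith
    then have "Suc j mod ?k < ?k" by simp
    moreover have "Suc i < ?k" using that k by linarith
    ultimately have "i = Suc j mod ?k \<or> Suc i = j \<or> Suc i = Suc j mod ?k"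
      using that f[of i] f[of j] k nth by auto
    moreover have "Suc j mod ?k = (if Suc j = ?k then 0 else Suc j)" using k by auto
    ultimately have "Suc i = j \<or> (i = 0 \<and> Suc j = ?k)"
      using that by (auto split: if_splits)
    then show ?thesis
    proof
      assume "Suc i = j" then show ?thesis by presburger
    next
      \<comment> \<open>The closing edge meets edge 0; its index \<open>m - 1\<close> is odd because
        \<open>m\<close> is even.\<close>
      assume a: "i = 0 \<and> Suc j = ?k"
      then have "m = ?k" using that assms(3) by simp
      then show ?thesis using a ev by simp presburger
    qed
  qed
  have "c (f i) \<noteq> c (f j)"
    if "i < m" "j < m" "f i \<noteq> f j" "ends (f i) \<inter> ends (f j) \<noteq> {}" for i j
  proof (cases "i < j")
    case True then show ?thesis using parity[of i j] that c by simp
  next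
    case False
    then have "j < i" using that by (metis linorder_neqE_nat)
    then show ?thesis using parity[of j i] that c by (simp add: Int_commute)
  qed
  then show ?thesis
    unfolding k_edge_colorable_def
    by (intro exI[of _ c]) (auto simp: c_def)
qed

section \<open>Cubic multigraphs and the comparison of \<open>nu 2\<close> with
  \<open>nu 3\<close>\<close>

locale cubic_multigraph =
  fixes V :: "'a set" and E :: "'e set" and ends :: "'e \<Rightarrow> 'a set"
  assumes cubic: "cubic_graph V E ends"
begin

lemma finite_V: "finite V" and finite_E: "finite E"
  and ends_subset: "e \<in> E \<Longrightarrow> ends e \<subseteq> V"
  and card_ends: "e \<in> E \<Longrightarrow> card (ends e) = 2"
  and degree: "v \<in> V \<Longrightarrow> card {e \<in> E. v \<in> ends e} = 3"
  using cubic unfolding cubic_graph_def by auto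

lemma nu_ge: 
  assumes "F \<subseteq> E" "k_edge_colorable k ends F"
  shows "card F \<le> nu k E ends"
proof -
  have "{card F |F. F \<subseteq> E \<and> k_edge_colorable k ends F} \<subseteq> card ` Pow E" by auto
  then have "finite {card F |F. F \<subseteq> E \<and> k_edge_colorable k ends F}"
    using finite_E by (meson finite_Pow_iff finite_imageI finite_subset)
  then show ?thesis unfolding nu_def using assms by (intro Max_ge) auto
qed

lemma nu_attained:
  obtains F where "F \<subseteq> E" "k_edge_colorable k ends F" "card F = nu k E ends"
proof -
  have "{card F |F. F \<subseteq> E \<and> k_edge_colorable k ends F} \<subseteq> card ` Pow E" by auto
  then have "finite {card F |F. F \<subseteq> E \<and> k_edge_colorable k ends F}"
    using finite_E by (meson finite_Pow_iff finite_imageI finite_subset)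
  moreover have "card {} \<in> {card F |F. F \<subseteq> E \<and> k_edge_colorable k ends F}"
    by (auto simp: k_edge_colorable_def intro: exI[of _ "{}"])
  ultimately have "nu k E ends \<in> {card F |F. F \<subseteq> E \<and> k_edge_colorable k ends F}"
    unfolding nu_def by (intro Max_in) auto
  then show ?thesis using that by auto
qed

text \<open>Deleting any one colour class of a maximum 3-colourable \<open>F\<close> leaves a
  2-colourable set, and the three sets so obtained contain every edge of \<open>F\<close> exactly
  twice.\<close>

lemma nu_2_ge_nu_3: "2 * nu 3 E ends \<le> 3 * nu 2 E ends"
proof -
  obtain F where F: "F \<subseteq> E" "k_edge_colorable 3 ends F" "card F = nu 3 E ends"
    using nu_attained by blast
  obtain c where c: "\<And>e. e \<in> F \<Longrightarrow> c e < (3::nat)"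
    "\<And>e1 e2. e1 \<in> F \<Longrightarrow> e2 \<in> F \<Longrightarrow> e1 \<noteq> e2 \<Longrightarrow> ends e1 \<inter> ends e2 \<noteq> {} \<Longrightarrow> c e1 \<noteq> c e2"
    using F(2) unfolding k_edge_colorable_def by blast
  have finF: "finite F" using F finite_E finite_subset by blast
  have drop: "card {e \<in> F. c e \<noteq> j} \<le> nu 2 E ends" if "j < 3" for j
  proof (rule nu_ge)
    \<comment> \<open>Colours above the deleted \<open>j\<close> move down by one, so that only 0
      and 1 remain.\<close>
    let ?d = "\<lambda>e. if c e > j then c e - 1 else c e"
    have "?d e < 2" if "e \<in> F" "c e \<noteq> j" for e
      using c(1)[OF that(1)] that(2) \<open>j < 3\<close> by auto
    moreover have "?d e1 \<noteq> ?d e2" if "e1 \<in> F" "e2 \<in> F" "c e1 \<noteq> j" "c e2 \<noteq> j" "e1 \<noteq> e2"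
      "ends e1 \<inter> ends e2 \<noteq> {}" for e1 e2
      using c(2)[of e1 e2] that by auto
    ultimately show "k_edge_colorable 2 ends {e \<in> F. c e \<noteq> j}"
      unfolding k_edge_colorable_def by (intro exI[of _ ?d]) blast
  qed (use F in auto)
  have part: "card {e \<in> F. c e \<noteq> j} + card {e \<in> F. c e = j} = card F" for j
    using finF by (subst card_Un_disjoint[symmetric]) (auto intro!: arg_cong[of _ _ card])
  moreover have "card F = card {e \<in> F. c e = 0} + card {e \<in> F. c e = 1} + card {e \<in> F. c e = 2}"
  proof -
    have "F = ({e \<in> F. c e = 0} \<union> {e \<in> F. c e = 1}) \<union> {e \<in> F. c e = 2}"
      using c(1) by (auto simp: numeral_eq_Suc less_Suc_eq)
    then have "card F = card (({e \<in> F. c e = 0} \<union> {e \<in> F. c e = 1}) \<union> {e \<in> F. c e = 2})" by simp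
    also have "\<dots> = card {e \<in> F. c e = 0} + card {e \<in> F. c e = 1} + card {e \<in> F. c e = 2}"
      using finF by (subst card_Un_disjoint; (subst card_Un_disjoint)?) auto
    finally show ?thesis .
  qed
  ultimately show ?thesis
    using drop[of 0] drop[of 1] drop[of 2] part[of 0] part[of 1] part[of 2] F(3) by linarith
qed

section \<open>Edges inside and edges leaving a vertex set\<close>

definition inner_edges :: "'a set \<Rightarrow> 'e set" where
  "inner_edges S = {e \<in> E. ends e \<subseteq> S}"

definition boundary :: "'a set \<Rightarrow> 'e set" where
  "boundary S = {e \<in> E. card (ends e \<inter> S) = 1}"

lemma finite_inner_edges [simp]: "finite (inner_edges S)"
  and finite_boundary [simp]: "finite (boundary S)"
  using finite_E by (auto simp: inner_edges_def boundary_def)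

text \<open>Double counting of incidences with \<open>S\<close>: an inner edge contributes 2, a
  boundary edge 1.\<close>

lemma handshake:
  assumes "S \<subseteq> V"
  shows "3 * card S = 2 * card (inner_edges S) + card (boundary S)"
proof -
  have finS: "finite S" using assms finite_V finite_subset by blast
  have "3 * card S = (\<Sum>v\<in>S. card {e \<in> E. v \<in> ends e})"
    using assms degree by (simp add: subset_iff)
  also have "\<dots> = (\<Sum>v\<in>S. \<Sum>e\<in>E. if v \<in> ends e then 1 else 0)"
    using finite_E by (simp add: sum.If_cases Int_def)
  also have "\<dots> = (\<Sum>e\<in>E. \<Sum>v\<in>S. if v \<in> ends e then 1 else 0)"
    by (rule sum.swap)
  also have "\<dots> = (\<Sum>e\<in>E. card (ends e \<inter> S))"
    using finS by (simp add: sum.If_cases Int_def conj_commute)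
  also have "\<dots> = (\<Sum>e\<in>E. 2 * (if ends e \<subseteq> S then 1 else 0) + (if card (ends e \<inter> S) = 1 then 1 else 0))"
  proof (rule sum.cong)
    fix e assume e: "e \<in> E"
    then obtain x y where xy: "ends e = {x, y}" "x \<noteq> y" using card_ends[OF e] by (auto simp: card_2_iff)
    show "card (ends e \<inter> S) = 2 * (if ends e \<subseteq> S then 1 else 0) + (if card (ends e \<inter> S) = 1 then 1 else 0)"
      using xy by (cases "x \<in> S"; cases "y \<in> S") (auto simp: Int_insert_left)
  qed simp
  also have "\<dots> = 2 * card (inner_edges S) + card (boundary S)"
    using finite_E by (simp add: sum.distrib sum_distrib_left[symmetric] sum.If_cases Int_def inner_edges_def boundary_def)
  finally show ?thesis .
qed

section \<open>Paths and their possible ends\<close>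

definition adj :: "'a \<Rightarrow> 'a \<Rightarrow> bool" where
  "adj u v \<longleftrightarrow> (\<exists>e\<in>E. ends e = {u, v})"

lemma adj_sym: "adj u v \<longleftrightarrow> adj v u"
  by (simp add: adj_def insert_commute)

definition gpath :: "'a list \<Rightarrow> bool" where
  "gpath xs \<longleftrightarrow> xs \<noteq> [] \<and> distinct xs \<and> successively adj xs"

text \<open>Single vertices are counted as closable by convention; the remaining, open paths then
  have at least three vertices.\<close>

definition closable :: "'a list \<Rightarrow> bool" where
  "closable xs \<longleftrightarrow> length xs = 1 \<or> adj (last xs) (hd xs)"

text \<open>A path on two vertices is always closable, but it spans a cycle only if its edge is doubled.\<close>

definition even_cycle :: "'a list \<Rightarrow> bool" where
  "even_cycle xs \<longleftrightarrow> even (length xs) \<and> closable xs \<and> (length xs = 2 \<longrightarrow> 2 \<le> card (inner_edges (set xs)))"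

text \<open>By parity a three-vertex set has one or at least three boundary edges; a triangle has
  just one exactly if one of its edges is doubled.\<close>

definition bad :: "'a list \<Rightarrow> bool" where
  "bad xs \<longleftrightarrow> length xs = 1 \<or> (length xs = 3 \<and> closable xs \<and> card (boundary (set xs)) < 3)"

text \<open>Possible ends of any path through exactly the vertices of \<open>xs\<close>, since an
  exchange may reorder a path within its vertex set.\<close>

definition starts :: "'a list \<Rightarrow> 'a set" where
  "starts xs = {hd zs | zs. gpath zs \<and> set zs = set xs}"

lemma gpath_rev: "gpath xs \<Longrightarrow> gpath (rev xs)"
  using successively_mono[of adj xs "\<lambda>x y. adj y x"] adj_sym by (simp add: gpath_def)

lemma gpath_append:
  "gpath xs \<Longrightarrow> gpath ys \<Longrightarrow> set xs \<inter> set ys = {} \<Longrightarrow> adj (last xs) (hd ys) \<Longrightarrow> gpath (xs @ ys)"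
  by (auto simp: gpath_def successively_append_iff)

lemma gpath_appendD:
  "gpath (xs @ ys) \<Longrightarrow> xs \<noteq> [] \<Longrightarrow> gpath xs" "gpath (xs @ ys) \<Longrightarrow> ys \<noteq> [] \<Longrightarrow> gpath ys"
  by (auto simp: gpath_def successively_append_iff)

lemma hd_in_starts: "gpath xs \<Longrightarrow> hd xs \<in> starts xs"
  by (auto simp: starts_def)

lemma last_in_starts: "gpath xs \<Longrightarrow> last xs \<in> starts xs"
  unfolding starts_def using gpath_rev[of xs] hd_rev[of xs] set_rev[of xs] by (metis (mono_tags) mem_Collect_eq)

text \<open>A closable path can be cut open before any vertex: \<open>as @ u # bs\<close> rotates to
  \<open>(u # bs) @ as\<close> across the closing edge.\<close>

lemma starts_closable:
  assumes "gpath xs" "closable xs"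
  shows "starts xs = set xs"
proof
  show "starts xs \<subseteq> set xs" unfolding starts_def gpath_def using hd_in_set by fastforce
  show "set xs \<subseteq> starts xs"
  proof
    fix u assume "u \<in> set xs"
    then obtain as bs where xs: "xs = as @ u # bs" by (meson split_list)
    show "u \<in> starts xs"
    proof (cases "as = []")
      case True then show ?thesis using hd_in_starts[OF assms(1)] xs by simp
    next
      case False
      then have "adj (last (u # bs)) (hd as)" using assms(2) xs by (auto simp: closable_def)
      then have "gpath ((u # bs) @ as)"
        using assms(1) False xs
        by (intro gpath_append) (auto simp: gpath_def successively_append_iff)
      then show ?thesis using xs unfolding starts_def by (force intro!: exI[of _ "(u # bs) @ as"])
    qed
  qed
qed

lemma closable_rev: "xs \<noteq> [] \<Longrightarrow> closable (rev xs) \<longleftrightarrow> closable xs"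
  by (simp add: closable_def hd_rev last_rev adj_sym)

lemma bad_rev: "bad (rev xs) \<longleftrightarrow> bad xs"
  by (cases "xs = []") (simp_all add: bad_def closable_rev)

lemma bad_not_even_cycle: "bad xs \<Longrightarrow> \<not> even_cycle xs"
  by (auto simp: bad_def even_cycle_def)

lemma bad_closable: "bad xs \<Longrightarrow> closable xs"
  by (auto simp: bad_def closable_def)

section \<open>Colouring the edges along one path\<close>

definition edge_of :: "'a \<Rightarrow> 'a \<Rightarrow> 'e" where
  "edge_of u v = (SOME e. e \<in> E \<and> ends e = {u, v})"

lemma edge_of: "adj u v \<Longrightarrow> edge_of u v \<in> E \<and> ends (edge_of u v) = {u, v}"
  unfolding edge_of_def adj_def by (rule someI_ex) blast

text \<open>Supplies the indexing for the parity colouring: as many edges as vertices for an even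
  cycle, one fewer otherwise. A doubled edge is treated apart, since \<open>edge_of\<close> returns
  the same edge in both directions.\<close>

lemma gpath_edges_circular:
  assumes "gpath xs"
  shows "\<exists>f m. inj_on f {..<m} \<and> m \<le> length xs \<and> (m = length xs \<longrightarrow> even m) \<and>
    (\<forall>i<m. f i \<in> E \<and> ends (f i) = {xs ! i, xs ! (Suc i mod length xs)}) \<and>
    m + (if even_cycle xs then 0 else 1) = length xs"
proof (cases "even_cycle xs \<and> length xs = 2")
  case True
  then have "2 \<le> card (inner_edges (set xs))" by (simp add: even_cycle_def)
  then obtain T where T: "T \<subseteq> inner_edges (set xs)" "card T = 2"
    using obtain_subset_with_card_n by metis
  then obtain e1 e2 where e: "T = {e1, e2}" "e1 \<noteq> e2" by (auto simp: card_2_iff)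
  obtain a b where ab: "xs = [a, b]" using True by (auto simp: length_Suc_conv numeral_2_eq_2)
  have E12: "e1 \<in> E" "e2 \<in> E" "ends e1 \<subseteq> {a, b}" "ends e2 \<subseteq> {a, b}"
    using T e ab by (auto simp: inner_edges_def)
  have "a \<noteq> b" using assms ab by (auto simp: gpath_def)
  have "ends e1 = {a, b}" "ends e2 = {a, b}"
    using E12 card_ends[of e1] card_ends[of e2] \<open>a \<noteq> b\<close>
    by (metis card_2_iff card_subset_eq finite.emptyI finite.insertI)+
  then show ?thesis
    using e E12 True ab
    by (intro exI[of _ "\<lambda>i. if i = 0 then e1 else e2"] exI[of _ "2::nat"])
       (auto simp: inj_on_def less_Suc_eq numeral_2_eq_2)
next
  case False
  define m where "m = (if even_cycle xs then length xs else length xs - 1)"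
  define f where "f i = edge_of (xs ! i) (xs ! (Suc i mod length xs))" for i
  have ne: "xs \<noteq> []" and d: "distinct xs" using assms by (auto simp: gpath_def)
  have adj: "adj (xs ! i) (xs ! (Suc i mod length xs))" if "i < m" for i
  proof (cases "Suc i = length xs")
    case True
    then have "even_cycle xs" "length xs \<noteq> 1" using that by (auto simp: m_def even_cycle_def split: if_splits)
    then have "adj (last xs) (hd xs)" by (auto simp: even_cycle_def closable_def)
    moreover have "Suc i mod length xs = 0" "i = length xs - 1" using True by auto
    ultimately show ?thesis using ne by (simp add: last_conv_nth hd_conv_nth)
  next
    case False
    then have "Suc i < length xs" using that by (auto simp: m_def split: if_splits)
    then show ?thesis using assms by (simp add: gpath_def successively_conv_nth)
  qed
  have f: "f i \<in> E \<and> ends (f i) = {xs ! i, xs ! (Suc i mod length xs)}" if "i < m" for i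
    unfolding f_def using edge_of[OF adj[OF that]] .
  have "inj_on f {..<m}"
  proof
    fix i j assume ij: "i \<in> {..<m}" "j \<in> {..<m}" and eq: "f i = f j"
    have k: "i < length xs" "j < length xs" using ij by (auto simp: m_def split: if_splits)
    have nth: "xs ! a = xs ! b \<longleftrightarrow> a = b" if "a < length xs" "b < length xs" for a b
      using that d by (simp add: nth_eq_iff_index_eq)
    have lt: "Suc a mod length xs < length xs" for a using ne by simp
    have "{xs ! i, xs ! (Suc i mod length xs)} = {xs ! j, xs ! (Suc j mod length xs)}"
      using f[of i] f[of j] ij eq by simp
    then consider "i = j" | "i = Suc j mod length xs" "Suc i mod length xs = j"
      unfolding doubleton_eq_iff nth[OF k] nth[OF k(1) lt] nth[OF lt k(2)] by satx
    then show "i = j"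
    proof cases
      case 2
      have "Suc a mod length xs = 0 \<and> Suc a = length xs \<or> Suc a mod length xs = Suc a"
        if "a < length xs" for a
        using that by (cases "Suc a = length xs") auto
      \<comment> \<open>Distinct indices that are each other's cyclic successor exist only on two
        vertices, and index 1 below \<open>m\<close> would make that an even cycle, the case already
        split off.\<close>
      from this[OF k(1)] this[OF k(2)] have "i = j \<or> (length xs = 2 \<and> (i = 1 \<or> j = 1))"
        unfolding 2(1)[symmetric] 2(2) by arith
      then show ?thesis using ij False by (auto simp: m_def)
    qed
  qed
  moreover have "length xs - 1 \<noteq> length xs" using ne by (cases xs) auto
  then have "m \<le> length xs" "m = length xs \<longrightarrow> even m" "m + (if even_cycle xs then 0 else 1) = length xs"
    using ne by (auto simp: m_def even_cycle_def Suc_le_eq)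
  ultimately show ?thesis using f by blast
qed

lemma card_inner_edges_gpath:
  assumes "gpath xs"
  shows "length xs \<le> card (inner_edges (set xs)) + 1"
proof -
  obtain f m where f: "inj_on f {..<m}" "m \<le> length xs" "m = length xs \<Longrightarrow> even m"
    "\<And>i. i < m \<Longrightarrow> f i \<in> E \<and> ends (f i) = {xs ! i, xs ! (Suc i mod length xs)}"
    "m + (if even_cycle xs then 0 else 1) = length xs"
    using gpath_edges_circular[OF assms] by blast
  have "Suc i mod length xs < length xs" for i using assms by (simp add: gpath_def)
  then have "f ` {..<m} \<subseteq> inner_edges (set xs)"
    using f(2,4) by (auto simp: inner_edges_def)
  then have "m \<le> card (inner_edges (set xs))"
    using f(1) by (metis card_image card_lessThan card_mono finite_inner_edges)
  then show ?thesis using f(5) by (auto split: if_splits)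
qed

lemma gpath_two_edge_colorable:
  assumes "gpath xs"
  obtains F where "F \<subseteq> E" "\<And>e. e \<in> F \<Longrightarrow> ends e \<subseteq> set xs" "k_edge_colorable 2 ends F"
    "length xs = card F + (if even_cycle xs then 0 else 1)"
proof -
  obtain f m where f: "inj_on f {..<m}" "m \<le> length xs" "m = length xs \<Longrightarrow> even m"
    "\<And>i. i < m \<Longrightarrow> f i \<in> E \<and> ends (f i) = {xs ! i, xs ! (Suc i mod length xs)}"
    "m + (if even_cycle xs then 0 else 1) = length xs"
    using gpath_edges_circular[OF assms] by blast
  have "Suc i mod length xs < length xs" for i using assms by (simp add: gpath_def)
  then show ?thesis
    using f assms two_edge_colorable_of_circular_indexing[of xs f m ends]
    by (intro that[of "f ` {..<m}"]) (auto simp: gpath_def card_image)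
qed

lemma odd_card_boundary:
  assumes "S \<subseteq> V" "odd (card S)"
  shows "odd (card (boundary S))"
proof -
  have "even (3 * card S) \<longleftrightarrow> even (card (boundary S))"
    unfolding handshake[OF assms(1)] by simp
  then show ?thesis using assms(2) by simp
qed

lemma card_neighbours_le:
  assumes "v \<in> V" "finite N" "\<And>x. x \<in> N \<Longrightarrow> adj v x"
  shows "card N \<le> 3"
proof -
  have e: "edge_of v x \<in> E \<and> ends (edge_of v x) = {v, x}" if "x \<in> N" for x
    using edge_of assms(3) that by blast
  have "inj_on (edge_of v) N"
  proof
    fix x y assume "x \<in> N" "y \<in> N" "edge_of v x = edge_of v y"
    then have "{v, x} = {v, y}" using e[of x] e[of y] by simp
    then show "x = y" by (auto simp: doubleton_eq_iff)
  qed
  then have "card N = card (edge_of v ` N)" by (simp add: card_image)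
  also have "\<dots> \<le> card {e \<in> E. v \<in> ends e}"
    using e finite_E by (intro card_mono) auto
  finally show ?thesis using degree[OF assms(1)] by simp
qed

lemma boundary_edge:
  assumes "e \<in> boundary S"
  obtains u v where "e \<in> E" "ends e = {u, v}" "adj u v" "u \<in> S" "v \<notin> S"
proof -
  have e: "e \<in> E" "card (ends e \<inter> S) = 1" using assms by (auto simp: boundary_def)
  then obtain x y where xy: "ends e = {x, y}" "x \<noteq> y" using card_ends[of e] by (auto simp: card_2_iff)
  have "adj x y" "adj y x" using e(1) xy(1) by (auto simp: adj_def insert_commute)
  then show ?thesis
    using e xy that[of x y] that[of y x] 
    by (cases "x \<in> S"; cases "y \<in> S") (auto simp: insert_commute)
qed

section \<open>Partitions of the vertices into paths\<close>

definition decomposition :: "'a list set \<Rightarrow> bool" where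
  "decomposition D \<longleftrightarrow> finite D \<and> (\<forall>xs\<in>D. gpath xs) \<and>
     (\<forall>xs\<in>D. \<forall>ys\<in>D. xs \<noteq> ys \<longrightarrow> set xs \<inter> set ys = {}) \<and> (\<Union>xs\<in>D. set xs) = V"

lemma card_V_decomposition:
  assumes "decomposition D"
  shows "card V = (\<Sum>xs\<in>D. length xs)"
proof -
  have "card V = (\<Sum>xs\<in>D. card (set xs))"
    using assms by (subst card_UN_disjoint[symmetric]) (auto simp: decomposition_def)
  also have "\<dots> = (\<Sum>xs\<in>D. length xs)"
    using assms by (intro sum.cong) (auto simp: decomposition_def gpath_def distinct_card)
  finally show ?thesis .
qed

text \<open>Edges chosen on different paths share no vertex, so the colourings combine; only a path
  that is not an even cycle has one edge fewer than vertices.\<close>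

lemma card_V_le_nu_2:
  assumes "decomposition D"
  shows "card V \<le> nu 2 E ends + card {xs \<in> D. \<not> even_cycle xs}"
proof -
  have "\<exists>F. F \<subseteq> E \<and> (\<forall>e\<in>F. ends e \<subseteq> set xs) \<and> k_edge_colorable 2 ends F \<and>
      length xs = card F + (if even_cycle xs then 0 else 1)" if "xs \<in> D" for xs
    using assms that gpath_two_edge_colorable[of xs] unfolding decomposition_def by metis
  then obtain Fs where Fs: "\<And>xs. xs \<in> D \<Longrightarrow> Fs xs \<subseteq> E"
    "\<And>xs e. xs \<in> D \<Longrightarrow> e \<in> Fs xs \<Longrightarrow> ends e \<subseteq> set xs"
    "\<And>xs. xs \<in> D \<Longrightarrow> k_edge_colorable 2 ends (Fs xs)"
    "\<And>xs. xs \<in> D \<Longrightarrow> length xs = card (Fs xs) + (if even_cycle xs then 0 else 1)"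
    by metis
  obtain cs where cs: "\<And>xs e. xs \<in> D \<Longrightarrow> e \<in> Fs xs \<Longrightarrow> cs xs e < (2::nat)"
    "\<And>xs e1 e2. xs \<in> D \<Longrightarrow> e1 \<in> Fs xs \<Longrightarrow> e2 \<in> Fs xs \<Longrightarrow> e1 \<noteq> e2 \<Longrightarrow>
       ends e1 \<inter> ends e2 \<noteq> {} \<Longrightarrow> cs xs e1 \<noteq> cs xs e2"
    using Fs(3) unfolding k_edge_colorable_def by metis
  have finD: "finite D" and disj: "\<And>xs ys. xs \<in> D \<Longrightarrow> ys \<in> D \<Longrightarrow> xs \<noteq> ys \<Longrightarrow> set xs \<inter> set ys = {}"
    using assms by (auto simp: decomposition_def)
  have ne: "ends e \<noteq> {}" if "xs \<in> D" "e \<in> Fs xs" for xs e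
    using card_ends[of e] Fs(1)[of xs] that by auto
  have same: "xs = ys"
    if "xs \<in> D" "ys \<in> D" "e1 \<in> Fs xs" "e2 \<in> Fs ys" "ends e1 \<inter> ends e2 \<noteq> {}" for xs ys e1 e2
    using disj[OF that(1,2)] Fs(2)[OF that(1,3)] Fs(2)[OF that(2,4)] that(5) by blast
  define G where "G = (\<Union>xs\<in>D. Fs xs)"
  define part where "part e = (SOME xs. xs \<in> D \<and> e \<in> Fs xs)" for e
  have part: "part e = xs" if "xs \<in> D" "e \<in> Fs xs" for xs e
  proof -
    have "part e \<in> D \<and> e \<in> Fs (part e)" unfolding part_def by (rule someI) (use that in blast)
    then show ?thesis using same[of "part e" xs e e] that ne[OF that] by blast
  qed
  have "k_edge_colorable 2 ends G"
    unfolding k_edge_colorable_def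
  proof (intro exI[of _ "\<lambda>e. cs (part e) e"] conjI ballI impI)
    fix e assume "e \<in> G"
    then show "cs (part e) e < 2" using cs(1) part by (auto simp: G_def)
  next
    fix e1 e2 assume e: "e1 \<in> G" "e2 \<in> G" "e1 \<noteq> e2 \<and> ends e1 \<inter> ends e2 \<noteq> {}"
    then obtain xs ys where xy: "xs \<in> D" "e1 \<in> Fs xs" "ys \<in> D" "e2 \<in> Fs ys" by (auto simp: G_def)
    then have "xs = ys" using same e by blast
    then show "cs (part e1) e1 \<noteq> cs (part e2) e2" using cs(2)[of xs e1 e2] part xy e by auto
  qed
  moreover have "G \<subseteq> E" using Fs(1) by (auto simp: G_def)
  ultimately have "card G \<le> nu 2 E ends" by (intro nu_ge)
  moreover have "card G = (\<Sum>xs\<in>D. card (Fs xs))"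
    unfolding G_def
  proof (rule card_UN_disjoint)
    show "\<forall>xs\<in>D. finite (Fs xs)" using Fs(1) finite_E finite_subset by blast
    show "\<forall>xs\<in>D. \<forall>ys\<in>D. xs \<noteq> ys \<longrightarrow> Fs xs \<inter> Fs ys = {}"
      using same ne by blast
  qed (rule finD)
  moreover have "card V = (\<Sum>xs\<in>D. card (Fs xs)) + card {xs \<in> D. \<not> even_cycle xs}"
  proof -
    have "card V = (\<Sum>xs\<in>D. card (Fs xs) + (if even_cycle xs then 0 else 1))"
      unfolding card_V_decomposition[OF assms] using Fs(4) by (intro sum.cong) auto
    also have "(\<Sum>xs\<in>D. if even_cycle xs then 0 else 1) = card {xs \<in> D. \<not> even_cycle xs}"
      using finD by (simp add: sum.If_cases Int_def)
    then have "(\<Sum>xs\<in>D. card (Fs xs) + (if even_cycle xs then 0 else 1)) =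
        (\<Sum>xs\<in>D. card (Fs xs)) + card {xs \<in> D. \<not> even_cycle xs}"
      by (simp add: sum.distrib)
    finally show ?thesis .
  qed
  ultimately show ?thesis by simp
qed

text \<open>Minimising the total of these weights simultaneously forbids joining paths (\<open>4 + 2 > 5\<close>) and
  prefers exchanges that reduce the number of bad paths.\<close>

definition weight :: "'a list \<Rightarrow> nat" where
  "weight xs = (if even_cycle xs then 2 else if bad xs then 5 else 4)"

section \<open>Ends and interiors of paths and the edges leaving them\<close>

definition tips :: "'a list \<Rightarrow> 'a set" where
  "tips xs = (if closable xs then set xs else {hd xs, last xs})"

definition inside :: "'a list \<Rightarrow> 'a set" where
  "inside xs = set xs - tips xs"

lemma tips_subset: "gpath xs \<Longrightarrow> tips xs \<subseteq> set xs"
  by (auto simp: tips_def gpath_def)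

text \<open>Connects the two notions of end: the count uses \<open>tips\<close>, the exchanges use
  \<open>starts\<close>, which may be larger for an open path.\<close>

lemma tips_subset_starts: "gpath xs \<Longrightarrow> tips xs \<subseteq> starts xs"
  by (simp add: tips_def starts_closable hd_in_starts last_in_starts)

lemma length_not_closable:
  assumes "gpath xs" "\<not> closable xs"
  shows "3 \<le> length xs"
proof (rule ccontr)
  assume "\<not> 3 \<le> length xs"
  moreover have "length xs \<noteq> 0" "length xs \<noteq> 1" using assms by (auto simp: closable_def gpath_def)
  ultimately have "length xs = 2" by linarith
  then obtain a b where "xs = [a, b]" by (auto simp: length_Suc_conv numeral_2_eq_2)
  then show False using assms by (simp add: gpath_def closable_def adj_sym)
qed

text \<open>The capacity of an open path on \<open>n\<close> vertices: its interior is a path on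
  \<open>n - 2\<close> vertices with at least \<open>n - 3\<close> inner edges, so at most
  \<open>3 * (n - 2) - 2 * (n - 3) = n\<close> edges leave it.\<close>

lemma card_boundary_inside:
  assumes "gpath xs" "set xs \<subseteq> V" "\<not> closable xs"
  shows "card (boundary (inside xs)) \<le> length xs"
proof -
  have len: "3 \<le> length xs" using length_not_closable assms by blast
  define a b ys where "a = hd xs" "b = last xs" "ys = butlast (tl xs)"
  have "tl xs \<noteq> []" using len by (cases xs) auto
  then have xs: "xs = a # ys @ [b]"
    unfolding a_b_ys_def by (cases xs) auto
  have "ys \<noteq> []" using len xs by auto
  then have "gpath ys" using assms(1) xs gpath_appendD[of "[a]" "ys @ [b]"] gpath_appendD[of ys "[b]"] by simp
  moreover have "inside xs = set ys"
    using assms xs by (auto simp: inside_def tips_def gpath_def)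
  moreover have "card (set ys) = length ys" using assms(1) xs by (simp add: gpath_def distinct_card)
  moreover have "set ys \<subseteq> V" using assms(2) xs by auto
  ultimately show ?thesis
    using handshake[of "set ys"] card_inner_edges_gpath[of ys] xs by simp
qed

text \<open>The two ends are distinct and, the path being open, not adjacent, so all six incidences
  leave. The path's own edges at its ends are among them.\<close>

lemma card_boundary_open_tips:
  assumes "gpath xs" "set xs \<subseteq> V" "\<not> closable xs"
  shows "card (boundary (tips xs)) = 6"
proof -
  have len: "3 \<le> length xs" using length_not_closable assms by blast
  have "hd xs \<noteq> last xs"
    using len assms(1) unfolding gpath_def
    by (cases xs) (auto split: if_splits)
  moreover have "inner_edges {hd xs, last xs} = {}"
  proof (rule ccontr)
    assume "inner_edges {hd xs, last xs} \<noteq> {}"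
    then obtain e where "e \<in> E" "ends e \<subseteq> {hd xs, last xs}" by (auto simp: inner_edges_def)
    moreover from this obtain u v where "ends e = {u, v}" "u \<noteq> v"
      using card_ends[of e] by (auto simp: card_2_iff)
    ultimately have "adj (last xs) (hd xs)" unfolding adj_def by (intro bexI[of _ e]) auto
    then show False using assms(3) by (simp add: closable_def)
  qed
  moreover have "{hd xs, last xs} \<subseteq> V" using assms(1,2) by (auto simp: gpath_def)
  ultimately show ?thesis
    using handshake[of "{hd xs, last xs}"] assms(3) by (simp add: tips_def)
qed

text \<open>By the handshake, one vertex gives \<open>1 + 3\<close>, two vertices without a doubled
  edge at least \<open>2 + 4\<close>, three vertices at least \<open>3 + 1\<close> if bad and
  otherwise \<open>3 + 3\<close>, by parity. Four would form an even cycle, and from five on the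
  vertices alone suffice.\<close>

lemma length_boundary_closable:
  assumes "gpath xs" "set xs \<subseteq> V" "closable xs" "\<not> even_cycle xs"
  shows "(if bad xs then 4 else 5) \<le> length xs + card (boundary (set xs))"
proof -
  have card: "card (set xs) = length xs" using assms(1) by (simp add: gpath_def distinct_card)
  have "length xs \<noteq> 0" using assms(1) by (simp add: gpath_def)
  then consider "length xs = 1" | "length xs = 2" | "length xs = 3" | "length xs = 4" | "5 \<le> length xs" by linarith
  then show ?thesis
  proof cases
    case 1
    then have "3 = 2 * card (inner_edges (set xs)) + card (boundary (set xs))"
      using handshake[OF assms(2)] card by simp
    moreover have "inner_edges (set xs) = {}"
    proof (rule ccontr)
      assume "inner_edges (set xs) \<noteq> {}"
      then obtain e where "e \<in> E" "ends e \<subseteq> set xs" by (auto simp: inner_edges_def)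
      then show False using card_ends[of e] card 1 card_mono[of "set xs" "ends e"] by simp
    qed
    ultimately show ?thesis using 1 by (simp add: bad_def)
  next
    case 2
    then have "card (inner_edges (set xs)) < 2" using assms(3,4) by (auto simp: even_cycle_def)
    then show ?thesis using handshake[OF assms(2)] card 2 by simp
  next
    case 3
    then have "odd (card (boundary (set xs)))" using odd_card_boundary[OF assms(2)] card by simp
    then have "card (boundary (set xs)) \<noteq> 0" by (metis even_zero)
    then have "1 \<le> card (boundary (set xs))" by linarith
    moreover have "bad xs \<or> 3 \<le> card (boundary (set xs))" using 3 assms(3) by (simp add: bad_def not_less[symmetric])
    ultimately show ?thesis using 3 by auto
  next
    case 4
    then show ?thesis using assms(3,4) by (simp add: even_cycle_def)
  qed auto
qed

end

section \<open>Exchanges in a decomposition of minimal weight\<close>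

locale minimal_decomposition = cubic_multigraph +
  fixes D :: "'a list set"
  assumes decomposition: "decomposition D"
    and minimal: "decomposition D' \<Longrightarrow> sum weight D \<le> sum weight D'"
begin

lemma finite_D: "finite D" and gpath_D: "xs \<in> D \<Longrightarrow> gpath xs"
  and disjoint_D: "xs \<in> D \<Longrightarrow> ys \<in> D \<Longrightarrow> v \<in> set xs \<Longrightarrow> v \<in> set ys \<Longrightarrow> xs = ys"
  and cover_D: "v \<in> V \<Longrightarrow> \<exists>xs\<in>D. v \<in> set xs"
  and subset_D: "xs \<in> D \<Longrightarrow> set xs \<subseteq> V"
  using decomposition unfolding decomposition_def by blast+

text \<open>The exchange principle: swapping \<open>xs\<close> and \<open>ys\<close> for
  \<open>N\<close> gives another decomposition, and the weights of the untouched paths cancel in the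
  comparison.\<close>

lemma weight_replace:
  assumes "xs \<in> D" "ys \<in> D" "xs \<noteq> ys" "finite N" "\<And>zs. zs \<in> N \<Longrightarrow> gpath zs"
    and dis: "\<And>zs zs'. zs \<in> N \<Longrightarrow> zs' \<in> N \<Longrightarrow> zs \<noteq> zs' \<Longrightarrow> set zs \<inter> set zs' = {}"
    and un: "(\<Union>zs\<in>N. set zs) = set xs \<union> set ys"
  shows "weight xs + weight ys \<le> sum weight N"
proof -
  let ?R = "D - {xs, ys}"
  have sep: "set zs \<inter> set zs' = {}" if "zs \<in> N" "zs' \<in> ?R" for zs zs'
  proof -
    have "set zs \<subseteq> set xs \<union> set ys" using un that by blast
    then show ?thesis using that disjoint_D assms(1,2) by blast
  qed
  have "decomposition (?R \<union> N)"
    unfolding decomposition_def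
  proof (intro conjI)
    have "(\<Union>xs\<in>?R \<union> N. set xs) = (\<Union>xs\<in>?R. set xs) \<union> (set xs \<union> set ys)" using un by blast
    also have "\<dots> = (\<Union>xs\<in>D. set xs)" using assms(1,2) by blast
    finally show "(\<Union>xs\<in>?R \<union> N. set xs) = V" using decomposition by (simp add: decomposition_def)
    show "\<forall>xs\<in>?R \<union> N. \<forall>ys\<in>?R \<union> N. xs \<noteq> ys \<longrightarrow> set xs \<inter> set ys = {}"
      using sep dis disjoint_D by blast
  qed (use finite_D gpath_D assms in auto)
  then have "sum weight D \<le> sum weight (?R \<union> N)" by (rule minimal)
  also have "\<dots> \<le> sum weight ?R + sum weight N"
    using finite_D assms(4) by (simp add: sum_Un_nat)
  finally show ?thesis
    using assms(1-3) finite_D sum.subset_diff[of "{xs, ys}" D weight] by simp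
qed

text \<open>Otherwise the two paths, reordered to begin at \<open>u\<close> and \<open>v\<close>,
  join into one of weight at most 5, while \<open>xs\<close> and \<open>ys\<close> weigh at least
  \<open>4 + 2\<close>.\<close>

lemma even_cycle_of_adjacent_starts:
  assumes "xs \<in> D" "ys \<in> D" "xs \<noteq> ys" "u \<in> starts xs" "v \<in> starts ys" "adj u v"
  shows "even_cycle xs"
proof -
  obtain as bs where ab: "gpath as" "set as = set xs" "hd as = u" "gpath bs" "set bs = set ys" "hd bs = v"
    using assms(4,5) by (auto simp: starts_def)
  have "gpath (rev as @ bs)"
    using ab assms disjoint_D[OF assms(1,2)]
    by (intro gpath_append gpath_rev) (auto simp: gpath_def last_rev)
  then have "weight xs + weight ys \<le> sum weight {rev as @ bs}"
    using ab assms by (intro weight_replace) auto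
  then show ?thesis by (auto simp: weight_def split: if_splits)
qed

text \<open>If \<open>v\<close> were an end of another path, the two could be joined. So
  \<open>v\<close> is no end of its path, which is therefore open; it may be \<open>xs\<close>
  itself.\<close>

lemma edge_from_tips:
  assumes "xs \<in> D" "\<not> even_cycle xs" "u \<in> tips xs" "v \<notin> tips xs" "adj u v"
  obtains ys where "ys \<in> D" "\<not> closable ys" "v \<in> inside ys"
proof -
  have "v \<in> V" using assms(5) ends_subset by (auto simp: adj_def)
  then obtain ys where ys: "ys \<in> D" "v \<in> set ys" using cover_D by blast
  have "v \<notin> tips ys"
  proof (cases "xs = ys")
    case False
    then show ?thesis
      using even_cycle_of_adjacent_starts[OF assms(1) ys(1) False _ _ assms(5)] assms tips_subset_starts gpath_D ys
      by blast
  qed (use assms in simp)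
  then show ?thesis using that[of ys] ys by (auto simp: inside_def tips_def split: if_splits)
qed

text \<open>Rerouting: follow \<open>as\<close> to \<open>v\<close>, step to \<open>u\<close> and
  traverse \<open>B\<close>, leaving \<open>bs\<close> over. The old weights are
  \<open>5 + 4\<close>; if neither new path were bad, the new ones would be at most
  \<open>4 + 4\<close>. Fixing only the vertex set of \<open>Q\<close> allows reading it
  backwards.\<close>

lemma bad_suffix:
  assumes "B \<in> D" "bad B" "Q \<in> D" "\<not> closable Q"
    and Q: "gpath (as @ v # bs)" "set (as @ v # bs) = set Q" "as \<noteq> []" "bs \<noteq> []"
    and u: "u \<in> set B" "adj u v"
  shows "bad bs"
proof (rule ccontr)
  assume "\<not> bad bs"
  have "B \<noteq> Q" using assms bad_closable by blast
  have "u \<in> starts B" using starts_closable gpath_D assms bad_closable by blast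
  then obtain zs where zs: "gpath zs" "set zs = set B" "hd zs = u" by (auto simp: starts_def)
  have BQ: "set B \<inter> set Q = {}" using disjoint_D assms(1,3) \<open>B \<noteq> Q\<close> by blast
  have "gpath (as @ [v])" using Q(1) gpath_appendD(1)[of "as @ [v]" bs] by simp
  moreover have "adj v u" using u(2) adj_sym by blast
  ultimately have R: "gpath ((as @ [v]) @ zs)"
    using zs BQ Q(2) by (intro gpath_append[of "as @ [v]" zs]) auto
  have "gpath bs" using Q(1,4) gpath_appendD(2)[of "as @ [v]" bs] by simp
  have "set ((as @ [v]) @ zs) \<inter> set bs = {}"
    using zs BQ Q(1,2) by (auto simp: gpath_def)
  then have "weight B + weight Q \<le> sum weight {(as @ [v]) @ zs, bs}"
    using zs Q R \<open>gpath bs\<close> \<open>B \<noteq> Q\<close> assms(1,3) by (intro weight_replace) auto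
  moreover have "(as @ [v]) @ zs \<noteq> bs"
    using \<open>set ((as @ [v]) @ zs) \<inter> set bs = {}\<close> Q(4) by force
  moreover have "\<not> bad ((as @ [v]) @ zs)"
  proof
    \<comment> \<open>A bad result would consist of \<open>hd as\<close>, \<open>v\<close> and
      \<open>u\<close> only, and its closing edge would join \<open>B\<close> to an end of
      \<open>Q\<close>.\<close>
    assume b: "bad ((as @ [v]) @ zs)"
    have "as \<noteq> []" "zs \<noteq> []" using Q zs by (auto simp: gpath_def)
    then have len: "length as \<ge> 1" "length zs \<ge> 1" by (auto simp: Suc_le_eq)
    then have "length as + length zs = 2" and cl: "closable ((as @ [v]) @ zs)"
      using b by (auto simp: bad_def)
    then have "length zs = 1" using len by linarith
    then have "zs = [u]" using zs by (auto simp: length_Suc_conv)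
    then have "adj u (hd as)" using cl \<open>as \<noteq> []\<close> by (auto simp: closable_def)
    moreover have "hd as \<in> starts Q" using hd_in_starts[OF Q(1)] Q(2) \<open>as \<noteq> []\<close> by (simp add: starts_def)
    ultimately have "even_cycle B"
      using even_cycle_of_adjacent_starts assms(1,3) \<open>B \<noteq> Q\<close> \<open>u \<in> starts B\<close> by blast
    then show False using bad_not_even_cycle assms(2) by blast
  qed
  moreover have "weight B = 5" "weight Q = 4"
    using assms(2,4) bad_not_even_cycle bad_closable by (auto simp: weight_def even_cycle_def)
  ultimately show False using \<open>\<not> bad bs\<close> by (auto simp: weight_def split: if_splits)
qed

section \<open>Open paths hit by bad paths, and the final count\<close>

definition hits :: "'a list \<Rightarrow> 'a \<Rightarrow> 'a list \<Rightarrow> bool" where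
  "hits B v Q \<longleftrightarrow> B \<in> D \<and> bad B \<and> Q \<in> D \<and> \<not> closable Q \<and> v \<in> inside Q \<and> (\<exists>u\<in>set B. adj u v)"

text \<open>\<open>bad_suffix\<close> along \<open>Q\<close> gives \<open>bs\<close>, and along the
  reverse of \<open>Q\<close> it gives \<open>as\<close>.\<close>

lemma hits_split:
  assumes "hits B v Q"
  obtains as bs where "Q = as @ v # bs" "bad as" "bad bs" "as \<noteq> []" "bs \<noteq> []"
proof -
  have v: "v \<in> set Q" "v \<noteq> hd Q" "v \<noteq> last Q" using assms by (auto simp: hits_def inside_def tips_def)
  then obtain as bs where Q: "Q = as @ v # bs" by (meson split_list)
  have ne: "as \<noteq> []" "bs \<noteq> []" using v Q by auto
  obtain u where u: "u \<in> set B" "adj u v" "B \<in> D" "bad B" "Q \<in> D" "\<not> closable Q"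
    using assms by (auto simp: hits_def)
  have "gpath Q" using u gpath_D by blast
  then have "bad bs" using bad_suffix[of B Q as v bs u] Q ne u by simp
  moreover have "bad (rev as)"
    using bad_suffix[of B Q "rev bs" v "rev as" u] gpath_rev[OF \<open>gpath Q\<close>] Q ne u by auto
  ultimately show ?thesis using that Q ne bad_rev by blast
qed

text \<open>Bad sides have 1 or 3 vertices, so an earlier hit at \<open>v\<close> forces
  \<open>bs\<close> to have three vertices, \<open>v'\<close> among them. Being bad,
  \<open>bs\<close> has a single boundary edge by parity, yet both the path edge from
  \<open>v\<close> and the edge from \<open>u'\<close> to \<open>v'\<close> leave it.\<close>

lemma hits_not_before:
  assumes "hits B v Q" "hits B' v' Q" "Q = as @ v # bs" "Q = as' @ v' # bs'"
    "bad as" "bad bs" "bad as'" "bad bs'"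
  shows "\<not> length as < length as'"
proof
  assume less: "length as < length as'"
  have l: "length as + length bs = length as' + length bs'" using assms(3,4)
    by (metis add_Suc_right add_right_cancel length_Cons length_append nat.inject)
  have "length as \<in> {1, 3}" "length bs \<in> {1, 3}" "length as' \<in> {1, 3}" "length bs' \<in> {1, 3}"
    using assms(5-8) by (auto simp: bad_def)
  then have "length bs = 3" using l less by auto
  have v': "v' \<in> set bs"
    using assms(3,4) less by (auto simp: append_eq_append_conv2 append_eq_Cons_conv Cons_eq_append_conv)
  have Q: "gpath Q" "Q \<in> D" "set Q \<subseteq> V" using assms(1) gpath_D subset_D by (auto simp: hits_def)
  obtain u' where u': "u' \<in> set B'" "adj u' v'" "B' \<in> D" "bad B'" "\<not> closable Q" using assms(2) by (auto simp: hits_def)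
  have "u' \<notin> set Q" using u' Q disjoint_D bad_closable by blast
  have "bs \<noteq> []" using \<open>length bs = 3\<close> by auto
  have dv: "distinct Q" "adj v (hd bs)" using Q(1) \<open>bs \<noteq> []\<close> assms(3)
    by (auto simp: gpath_def successively_append_iff successively_Cons)
  have "v \<notin> set bs" "u' \<notin> set bs" "u' \<noteq> v" using dv assms(3) \<open>u' \<notin> set Q\<close> by auto
  then have "edge_of v (hd bs) \<in> boundary (set bs)" "edge_of u' v' \<in> boundary (set bs)"
      "edge_of v (hd bs) \<noteq> edge_of u' v'"
    using edge_of[OF dv(2)] edge_of[OF u'(2)] v' \<open>bs \<noteq> []\<close>
    by (auto simp: boundary_def Int_insert_left)
  then have "2 \<le> card (boundary (set bs))"
    by (metis card_2_iff card_mono empty_subsetI finite_boundary insert_subset)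
  moreover have "odd (card (boundary (set bs)))"
    using odd_card_boundary[of "set bs"] Q(3) dv(1) assms(3) \<open>length bs = 3\<close> by (auto simp: distinct_card)
  moreover have "card (boundary (set bs)) < 3" using assms(6) \<open>length bs = 3\<close> by (simp add: bad_def)
  ultimately show False by (metis even_numeral le_antisym less_Suc_eq_le numeral_2_eq_2 numeral_3_eq_3)
qed

text \<open>By \<open>hits_not_before\<close> in both orders, the hits occur at the same vertex.
  Different bad paths would then give it four neighbours: one in each of them and two on
  \<open>Q\<close>.\<close>

lemma hits_unique:
  assumes "hits B v Q" "hits B' v' Q"
  shows "B = B'"
proof (rule ccontr)
  assume "B \<noteq> B'"
  obtain as bs where s: "Q = as @ v # bs" "bad as" "bad bs" "as \<noteq> []" "bs \<noteq> []" using hits_split[OF assms(1)] .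
  obtain as' bs' where s': "Q = as' @ v' # bs'" "bad as'" "bad bs'" using hits_split[OF assms(2)] .
  have "length as = length as'"
    using hits_not_before[OF assms s(1) s'(1) s(2,3) s'(2,3)]
      hits_not_before[OF assms(2,1) s'(1) s(1) s'(2,3) s(2,3)] by linarith
  then have "v = v'" using s(1) s'(1) by simp
  obtain u where u: "u \<in> set B" "adj u v" "B \<in> D" "bad B" "\<not> closable Q" "Q \<in> D" using assms(1) by (auto simp: hits_def)
  obtain u' where u': "u' \<in> set B'" "adj u' v" "B' \<in> D" "bad B'" using assms(2) \<open>v = v'\<close> by (auto simp: hits_def)
  have Q: "distinct Q" "adj (last as) v" "adj v (hd bs)"
    using gpath_D[OF u(6)] s by (auto simp: gpath_def successively_append_iff successively_Cons)
  have "u \<notin> set Q" "u' \<notin> set Q" "u \<noteq> u'" using u u' disjoint_D bad_closable \<open>B \<noteq> B'\<close> by blast+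
  moreover have "last as \<in> set as" "hd bs \<in> set bs" using s by auto
  moreover from this have "last as \<noteq> hd bs" using Q(1) s(1) by auto
  ultimately have "u \<notin> {u', last as, hd bs}" "u' \<notin> {last as, hd bs}" "last as \<noteq> hd bs"
    using s(1) by auto
  then have "card {u, u', last as, hd bs} = 4" by simp
  moreover have "v \<in> V" using subset_D[OF u(6)] s(1) by auto
  ultimately show False
    using card_neighbours_le[of v "{u, u', last as, hd bs}"] Q u u' adj_sym by auto
qed

text \<open>A bad path has an odd number of vertices, hence a leaving edge, which ends inside an
  open path. Choosing one such open path for each bad path is injective by
  \<open>hits_unique\<close>.\<close>

lemma card_bad_le: "card {xs \<in> D. bad xs} \<le> card {xs \<in> D. \<not> closable xs}"
proof -
  have "\<exists>Q v. hits B v Q" if B: "B \<in> D" "bad B" for B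
  proof -
    have "odd (card (set B))" 
      using B gpath_D by (auto simp: bad_def gpath_def distinct_card)
    then have "boundary (set B) \<noteq> {}" using odd_card_boundary[OF subset_D[OF B(1)]] by auto
    then obtain e where "e \<in> boundary (set B)" by blast
    then obtain u v where uv: "adj u v" "u \<in> set B" "v \<notin> set B" by (rule boundary_edge)
    have "tips B = set B" using B bad_closable by (simp add: tips_def)
    then obtain Q where "Q \<in> D" "\<not> closable Q" "v \<in> inside Q"
      using edge_from_tips[of B u v] uv B bad_not_even_cycle by metis
    then show ?thesis using uv B by (auto simp: hits_def)
  qed
  then obtain q where q: "\<And>B. B \<in> D \<Longrightarrow> bad B \<Longrightarrow> \<exists>v. hits B v (q B)" by metis
  show ?thesis
  proof (rule card_inj_on_le[of q])
    show "inj_on q {xs \<in> D. bad xs}"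
      using q hits_unique by (intro inj_onI) (metis (mono_tags, lifting) mem_Collect_eq)
    show "q ` {xs \<in> D. bad xs} \<subseteq> {xs \<in> D. \<not> closable xs}" using q by (fastforce simp: hits_def)
  qed (use finite_D in simp)
qed

text \<open>Each edge counted on the left enters the interior of an open path, so
  \<open>card_boundary_inside\<close> bounds their number. The end edges of an open path occur in
  its own capacity as well.\<close>

lemma sum_boundary_tips_le:
  "(\<Sum>xs | xs \<in> D \<and> \<not> even_cycle xs. card (boundary (tips xs))) \<le> (\<Sum>xs | xs \<in> D \<and> \<not> closable xs. length xs)"
proof -
  let ?N = "{xs \<in> D. \<not> even_cycle xs}" and ?O = "{xs \<in> D. \<not> closable xs}"
  have fin: "finite ?N" "finite ?O" using finite_D by auto
  have escape: "\<exists>ys\<in>?O. \<exists>u v. e \<in> E \<and> ends e = {u, v} \<and> u \<in> tips xs \<and> v \<in> inside ys"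
    if xs: "xs \<in> ?N" and e: "e \<in> boundary (tips xs)" for xs e
  proof -
    obtain u v where uv: "e \<in> E" "ends e = {u, v}" "adj u v" "u \<in> tips xs" "v \<notin> tips xs"
      using boundary_edge[OF e] .
    moreover obtain ys where "ys \<in> D" "\<not> closable ys" "v \<in> inside ys"
      using edge_from_tips[of xs u v] uv xs by blast
    ultimately show ?thesis by blast
  qed
  have tips_inside: "v \<notin> inside ys" if "xs \<in> D" "ys \<in> D" "v \<in> tips xs" for xs ys v
    using that disjoint_D tips_subset gpath_D unfolding inside_def by blast
  have "(\<Sum>xs\<in>?N. card (boundary (tips xs))) = card (\<Union>xs\<in>?N. boundary (tips xs))"
  proof (rule card_UN_disjoint[symmetric])
    show "\<forall>xs\<in>?N. \<forall>ys\<in>?N. xs \<noteq> ys \<longrightarrow> boundary (tips xs) \<inter> boundary (tips ys) = {}"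
    proof (intro ballI impI equals0I)
      fix xs ys e
      assume a: "xs \<in> ?N" "ys \<in> ?N" "xs \<noteq> ys" "e \<in> boundary (tips xs) \<inter> boundary (tips ys)"
      then obtain zs u v where z: "zs \<in> ?O" "ends e = {u, v}" "u \<in> tips xs" "v \<in> inside zs"
        using escape[of xs e] by blast
      obtain w where "w \<in> ends e" "w \<in> tips ys" using a(4) boundary_edge[of e "tips ys"] by blast
      moreover have "v \<notin> tips ys" using tips_inside[of ys zs v] z a by blast
      \<comment> \<open>The endpoint \<open>v\<close> is interior and so an end of no path; a shared
        edge thus makes \<open>u\<close> an end of both.\<close>
      ultimately have "u \<in> tips ys" using z(2) by auto
      then have "xs = ys" using disjoint_D tips_subset gpath_D a z by blast
      then show False using a by blast
    qed
  qed (use fin in auto)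
  also have "\<dots> \<le> card (\<Union>ys\<in>?O. boundary (inside ys))"
  proof (rule card_mono)
    show "(\<Union>xs\<in>?N. boundary (tips xs)) \<subseteq> (\<Union>ys\<in>?O. boundary (inside ys))"
    proof
      fix e assume "e \<in> (\<Union>xs\<in>?N. boundary (tips xs))"
      then obtain xs where xs: "xs \<in> ?N" "e \<in> boundary (tips xs)" by blast
      then obtain ys u v where y: "ys \<in> ?O" "e \<in> E" "ends e = {u, v}" "u \<in> tips xs" "v \<in> inside ys"
        using escape by blast
      then have "u \<notin> inside ys" using tips_inside xs by blast
      then have "e \<in> boundary (inside ys)" using y by (auto simp: boundary_def Int_insert_left)
      then show "e \<in> (\<Union>ys\<in>?O. boundary (inside ys))" using y by blast
    qed
  qed (use fin in auto)
  also have "\<dots> \<le> (\<Sum>ys\<in>?O. card (boundary (inside ys)))" by (rule card_UN_le[OF fin(2)])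
  also have "\<dots> \<le> (\<Sum>ys\<in>?O. length ys)"
    using card_boundary_inside gpath_D subset_D by (intro sum_mono) blast
  finally show ?thesis .
qed

text \<open>The closable paths need \<open>5 * card C\<close>, less one per bad path, in vertices
  and leaving edges. These edges and the \<open>6 * card O'\<close> at open ends fit into the
  vertices of the open paths. By \<open>card_bad_le\<close>, the sixth unit of each open path covers
  the bad ones.\<close>

lemma five_card_le_card_V: "5 * card {xs \<in> D. \<not> even_cycle xs} \<le> card V"
proof -
  define N O' C where "N = {xs \<in> D. \<not> even_cycle xs}" "O' = {xs \<in> D. \<not> closable xs}"
    "C = {xs \<in> N. closable xs}"
  note defs = this
  have fin: "finite N" "finite O'" "finite C" using finite_D by (auto simp: defs)
  have N: "N = O' \<union> C" "O' \<inter> C = {}" by (auto simp: defs even_cycle_def)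
  have "(\<Sum>xs\<in>C. (if bad xs then 4 else 5)) \<le> (\<Sum>xs\<in>C. length xs + card (boundary (tips xs)))"
    using length_boundary_closable gpath_D subset_D by (intro sum_mono) (auto simp: defs tips_def)
  moreover have "(\<Sum>xs\<in>C. (if bad xs then 4 else 5)) + card {xs \<in> D. bad xs} = 5 * card C"
  proof -
    have "{xs \<in> D. bad xs} = {xs \<in> C. bad xs}"
      using bad_not_even_cycle bad_closable by (auto simp: defs)
    then have "card {xs \<in> D. bad xs} = (\<Sum>xs\<in>C. if bad xs then 1 else 0)"
      using fin by (simp add: sum.If_cases Int_def)
    then have "(\<Sum>xs\<in>C. (if bad xs then 4 else 5)) + card {xs \<in> D. bad xs} =
       (\<Sum>xs\<in>C. (if bad xs then 4 else 5) + (if bad xs then 1 else 0))"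
      by (simp only: sum.distrib)
    also have "\<dots> = (\<Sum>xs\<in>C. 5)" by (intro sum.cong) auto
    finally show ?thesis by simp
  qed
  moreover have "(\<Sum>xs\<in>O'. card (boundary (tips xs))) = 6 * card O'"
    using card_boundary_open_tips gpath_D subset_D by (simp add: defs)
  moreover have "(\<Sum>xs\<in>N. card (boundary (tips xs))) \<le> (\<Sum>xs\<in>O'. length xs)"
    using sum_boundary_tips_le by (simp add: defs)
  moreover have "(\<Sum>xs\<in>N. card (boundary (tips xs))) = (\<Sum>xs\<in>O'. card (boundary (tips xs))) + (\<Sum>xs\<in>C. card (boundary (tips xs)))"
    unfolding N(1) using fin N(2) by (intro sum.union_disjoint)
  moreover have "(\<Sum>xs\<in>O'. length xs) + (\<Sum>xs\<in>C. length xs) \<le> card V"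
  proof -
    have "(\<Sum>xs\<in>O'. length xs) + (\<Sum>xs\<in>C. length xs) = (\<Sum>xs\<in>N. length xs)"
      unfolding N(1) using fin N(2) by (intro sum.union_disjoint[symmetric])
    also have "\<dots> \<le> (\<Sum>xs\<in>D. length xs)" using finite_D by (intro sum_mono2) (auto simp: defs)
    finally show ?thesis using card_V_decomposition[OF decomposition] by simp
  qed
  moreover have "card {xs \<in> D. bad xs} \<le> card O'" using card_bad_le by (simp add: defs)
  moreover have "card N = card O' + card C" unfolding N(1) using fin N(2) by (rule_tac card_Un_disjoint)
  ultimately show ?thesis unfolding defs(1)[symmetric] by (simp add: sum.distrib)
qed

end

section \<open>The bound by the number of vertices, and the conclusion\<close>

context cubic_multigraph begin

lemma four_card_V_le_nu_2: "4 * card V \<le> 5 * nu 2 E ends"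
proof -
  \<comment> \<open>Single vertices form a decomposition, so one of least total weight
    exists.\<close>
  have "decomposition ((\<lambda>v. [v]) ` V)"
    using finite_V by (auto simp: decomposition_def gpath_def)
  then obtain D where D: "decomposition D" "\<And>D'. decomposition D' \<Longrightarrow> sum weight D \<le> sum weight D'"
    using ex_has_least_nat[of decomposition _ "sum weight"] by blast
  interpret minimal_decomposition V E ends D
    using D by unfold_locales
  show ?thesis
    using five_card_le_card_V card_V_le_nu_2[OF D(1)] by linarith
qed

end

theorem theorem4:
  fixes V :: "'a set" and E :: "'e set" and ends :: "'e \<Rightarrow> 'a set"
  assumes "cubic_graph V E ends"
  shows "real (nu 2 E ends) \<ge> 16 / 17 * ((real (card V) + 2 * real (nu 3 E ends)) / 4)"
proof -
  interpret cubic_multigraph V E ends by unfold_locales (rule assms)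
  \<comment> \<open>The bounds say that \<open>card V\<close> is at most \<open>5/4\<close> and
    \<open>2 * nu 3\<close> at most \<open>3\<close> times \<open>nu 2\<close>; the sum
    \<open>17/4\<close> is the source of the 17.\<close>
  have "real (4 * card V) \<le> real (5 * nu 2 E ends)" "real (2 * nu 3 E ends) \<le> real (3 * nu 2 E ends)"
    using four_card_V_le_nu_2 nu_2_ge_nu_3 unfolding of_nat_le_iff .
  then show ?thesis by simp
qed

end
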